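(* Let $1\le k<n$, $A\in\mathbb{R}^{m\times n}$, $b\in\mathbb{R}^m$, $\rho>0$, and let $L\in\mathbb{R}^{k\times n}$ have full row rank. Let $F\in\mathbb{R}^{n\times(n-k)}$ have columns forming an orthonormal basis of the null space of $L$, put $$l_1=\lambda_{\min}(F^TA^TAF),\qquad l_2=\lambda_{\min}\begin{bmatrix}F^TA^TAF&F^TA^Tb\\ b^TAF&\|b\|^2\end{bmatrix},$$ and assume $l_2<l_1$. Let $x^*$ be any globally optimal solution of $$\min_{x\in\mathbb{R}^n}\ \frac{\|Ax-b\|^2}{\|x\|^2+1}+\rho\|Lx\|^2.$$ Let $\beta=2\lambda_{\max}(A^TA)$, $\gamma=2\|A^Tb\|$, $\zeta=\rho\,\lambda_{\min}(LL^T)$. Then $$\|x^*\|^2\le-\frac12+\frac{l_2}{2\zeta}+\frac{\sqrt{(\zeta-l_2)^2+\beta^2+4\zeta l_2+\frac{\gamma^2}{l_1-l_2}\zeta}}{2\zeta}+\left(\frac{\gamma+\sqrt{\gamma^2+(l_1-l_2)\left(4l_2+\frac{\beta^2}{\zeta}+\frac{(\zeta-l_2)^2}{\zeta}\right)}}{2(l_1-l_2)}\right)^2.$$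
   Context: $\lambda_{\min}(\cdot)$ and $\lambda_{\max}(\cdot)$ are the smallest and largest eigenvalues of a symmetric matrix; $\|\cdot\|$ is the Euclidean norm. *)

theory Defs
  imports "HOL-Analysis.Analysis"
begin

definition eigenvalue :: "real^'n^'n \<Rightarrow> real \<Rightarrow> bool" where
  "eigenvalue M e \<longleftrightarrow> (\<exists>v. v \<noteq> 0 \<and> M *v v = e *\<^sub>R v)"

(* Min and Max are meaningful here because a symmetric real matrix has a finite nonempty
   set of eigenvalues; the two functions are applied to symmetric matrices only. *)
definition lambda_min :: "real^'n^'n \<Rightarrow> real" where
  "lambda_min M = Min {e. eigenvalue M e}"

definition lambda_max :: "real^'n^'n \<Rightarrow> real" where
  "lambda_max M = Max {e. eigenvalue M e}"

(* [P Q; R S], with the sum type indexing the concatenated rows (columns). *)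
definition block_matrix ::
  "real^'c^'r \<Rightarrow> real^'d^'r \<Rightarrow> real^'c^'s \<Rightarrow> real^'d^'s \<Rightarrow> real^('c + 'd)^('r + 's)" where
  "block_matrix P Q R S =
     (\<chi> i j. case i of
         Inl r \<Rightarrow> (case j of Inl c \<Rightarrow> P $ r $ c | Inr d \<Rightarrow> Q $ r $ d)
       | Inr s \<Rightarrow> (case j of Inl c \<Rightarrow> R $ s $ c | Inr d \<Rightarrow> S $ s $ d))"

definition null_space :: "real^'n^'m \<Rightarrow> (real^'n) set" where
  "null_space M = {x. M *v x = 0}"

(* Orthonormality is stated for the indexed family of columns, so that repeated columns
   are excluded; it implies linear independence. *)
definition columns_orthonormal_basis :: "real^'p^'n \<Rightarrow> (real^'n) set \<Rightarrow> bool" where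
  "columns_orthonormal_basis F V \<longleftrightarrow>
     (\<forall>i j. column i F \<bullet> column j F = (if i = j then 1 else 0)) \<and> span (columns F) = V"

end

theory Submission
  imports Defs
begin

text \<open>
  Homogenising the total least squares problem on the null space of \<open>L\<close>, the eigenvector belonging
  to \<open>l\<^sub>2\<close> has nonzero last coordinate because \<open>l\<^sub>2 < l\<^sub>1\<close>, and rescaling it gives a point \<open>y\<close> with
  \<open>L y = 0\<close> and objective value \<open>l\<^sub>2\<close>. So the objective at the minimiser is at most \<open>l\<^sub>2\<close>. Split the
  minimiser as \<open>F v + z\<close> with \<open>z\<close> in the row space of \<open>L\<close>, and write \<open>r = \<parallel>v\<parallel>\<close>, \<open>s = \<parallel>z\<parallel>\<close>. Dropping
  \<open>\<parallel>A z - b\<parallel>\<^sup>2 \<ge> 0\<close> and estimating the cross terms yields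
  \<open>(l\<^sub>1 - l\<^sub>2) r\<^sup>2 - \<gamma> r - \<beta> r s + \<zeta> s\<^sup>2 r\<^sup>2 + \<zeta> s\<^sup>4 + (\<zeta> - l\<^sub>2) s\<^sup>2 \<le> l\<^sub>2\<close>.
  Completing squares turns this into one quadratic inequality for \<open>r\<close> and one for \<open>s\<^sup>2\<close>.
\<close>

section \<open>Extremal eigenvalues and quadratic forms\<close>

lemma inner_matrix_vector_transpose:
  fixes M :: "real^'n^'m"
  shows "(M *v x) \<bullet> y = x \<bullet> (transpose M *v y)"
  by (metis dot_lmul_matrix inner_commute transpose_matrix_vector)

lemma inner_gram:
  fixes M :: "real^'n^'m"
  shows "x \<bullet> ((transpose M ** M) *v x) = (norm (M *v x))\<^sup>2"
  by (metis inner_matrix_vector_transpose matrix_vector_mul_assoc power2_norm_eq_inner)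

lemma symmetric_gram:
  fixes M :: "real^'n^'m"
  shows "transpose (transpose M ** M) = transpose M ** M"
  by (simp add: matrix_transpose_mul transpose_transpose)

text \<open>Eigenvectors of a symmetric matrix for distinct eigenvalues are orthogonal, so choosing
  one for each eigenvalue gives an independent family, which is finite. This is what makes
  \<open>Min\<close> and \<open>Max\<close> over the eigenvalues genuine bounds.\<close>

lemma finite_eigenvalues:
  fixes M :: "real^'n^'n"
  assumes sym: "transpose M = M"
  shows "finite {e. eigenvalue M e}"
proof -
  define f where "f e = (SOME v. v \<noteq> 0 \<and> M *v v = e *\<^sub>R v)" for e
  have f: "f e \<noteq> 0" "M *v f e = e *\<^sub>R f e" if "eigenvalue M e" for e
    using someI_ex[of "\<lambda>v. v \<noteq> 0 \<and> M *v v = e *\<^sub>R v"] that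
    unfolding eigenvalue_def f_def by auto
  have orth: "f d \<bullet> f e = 0" if "eigenvalue M d" "eigenvalue M e" "d \<noteq> e" for d e
  proof -
    have "d * (f d \<bullet> f e) = e * (f d \<bullet> f e)"
      using inner_matrix_vector_transpose[of M "f d" "f e"] sym f that by simp
    then show ?thesis using that(3) by simp
  qed
  have "inj_on f {e. eigenvalue M e}"
    using orth f(1) by (fastforce intro!: inj_onI)
  moreover have "independent (f ` {e. eigenvalue M e})"
  proof (rule pairwise_orthogonal_independent)
    show "pairwise orthogonal (f ` {e. eigenvalue M e})"
      using orth by (auto simp: pairwise_def orthogonal_def)
    show "0 \<notin> f ` {e. eigenvalue M e}"
      using f(1) by fastforce
  qed
  ultimately show ?thesis
    using finite_imageD independent_imp_finite by blast
qed

text \<open>The vector \<open>u\<close> minimises the form, so the derivative at \<open>u\<close>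
  along \<open>w = N *v u\<close>, namely \<open>2 * (w \<bullet> w)\<close>, has to vanish.\<close>

lemma psd_form_zero_imp_kernel:
  fixes N :: "real^'n^'n"
  assumes sym: "transpose N = N" and psd: "\<And>v. 0 \<le> v \<bullet> (N *v v)" and "u \<bullet> (N *v u) = 0"
  shows "N *v u = 0"
proof -
  \<comment> \<open>The form at \<open>u + t *\<^sub>R w\<close> is
    \<open>2 * t * q + t\<^sup>2 * c\<close>. Its minimiser would be \<open>- q / c\<close>; the
    added 1 keeps the denominator positive when \<open>c = 0\<close>, and the value stays negative
    unless \<open>q = 0\<close>.\<close>
  define w q c t where "w = N *v u" and "q = w \<bullet> w" and "c = w \<bullet> (N *v w)" and "t = - q / (c + 1)"
  have c: "0 \<le> c" unfolding c_def by (rule psd)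
  have uw: "u \<bullet> (N *v w) = q"
    using inner_matrix_vector_transpose[of N u w] sym by (simp add: q_def w_def)
  have "0 \<le> (u + t *\<^sub>R w) \<bullet> (N *v (u + t *\<^sub>R w))" by (rule psd)
  also have "\<dots> = 2 * t * q + t\<^sup>2 * c"
    using assms(3) uw
    by (simp add: matrix_vector_right_distrib matrix_vector_mult_scaleR inner_add_left inner_add_right
        power2_eq_square algebra_simps flip: w_def q_def c_def)
  also have "\<dots> = - (q\<^sup>2 * (c + 2) / (c + 1)\<^sup>2)"
    using c unfolding t_def by (simp add: divide_simps power2_eq_square) (simp add: algebra_simps)
  finally have "q\<^sup>2 * (c + 2) / (c + 1)\<^sup>2 \<le> 0" by simp
  then have "q\<^sup>2 * (c + 2) \<le> 0" using c by (simp add: divide_le_0_iff)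
  then have "q = 0" using c by (simp add: mult_le_0_iff)
  then show ?thesis by (simp add: q_def w_def)
qed

text \<open>Compactness of the unit sphere yields a minimiser \<open>u\<close> of the form, with
  value \<open>e\<close>. Subtracting \<open>e\<close> times the identity leaves a positive
  semidefinite form that vanishes at \<open>u\<close>, so \<open>u\<close> lies in its kernel and is
  an eigenvector for \<open>e\<close>.\<close>

lemma rayleigh_minimum:
  fixes M :: "real^'n^'n"
  assumes sym: "transpose M = M"
  obtains e where "eigenvalue M e" "\<And>v. e * (norm v)\<^sup>2 \<le> v \<bullet> (M *v v)"
proof -
  have "continuous_on (sphere 0 1) (\<lambda>v. v \<bullet> (M *v v))"
    by (intro continuous_intros linear_continuous_on matrix_vector_mul_bounded_linear)
  moreover have "sphere (0 :: real^'n) 1 \<noteq> {}" by simp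
  ultimately obtain u where u: "norm u = 1"
    and least: "\<And>v. norm v = 1 \<Longrightarrow> u \<bullet> (M *v u) \<le> v \<bullet> (M *v v)"
    using continuous_attains_inf[of "sphere 0 1" "\<lambda>v. v \<bullet> (M *v v)"] by auto
  define e where "e = u \<bullet> (M *v u)"
  have bound: "e * (norm v)\<^sup>2 \<le> v \<bullet> (M *v v)" for v
  proof (cases "v = 0")
    case False
    then have "e \<le> (inverse (norm v) *\<^sub>R v) \<bullet> (M *v (inverse (norm v) *\<^sub>R v))"
      unfolding e_def by (intro least) simp
    then show ?thesis
      using False by (simp add: matrix_vector_mult_scaleR field_simps power2_eq_square)
  qed simp
  define N where "N = M - e *\<^sub>R mat 1"
  have N: "N *v v = M *v v - e *\<^sub>R v" for v
    unfolding N_def by (simp add: matrix_vector_mult_diff_rdistrib scaleR_matrix_vector_assoc[symmetric])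
  have "N *v u = 0"
  proof (rule psd_form_zero_imp_kernel)
    show "transpose N = N"
      using sym unfolding N_def by (simp add: transpose_def vec_eq_iff mat_def)
    show "0 \<le> v \<bullet> (N *v v)" for v
      using bound[of v] by (simp add: N inner_diff_right power2_norm_eq_inner)
    show "u \<bullet> (N *v u) = 0"
      using u by (simp add: N inner_diff_right e_def norm_eq_1)
  qed
  then have "eigenvalue M e"
    using u unfolding eigenvalue_def N by (intro exI[of _ u]) auto
  with bound that show thesis by blast
qed

lemma lambda_min_mult_le:
  fixes M :: "real^'n^'n"
  assumes "transpose M = M"
  shows "lambda_min M * (norm v)\<^sup>2 \<le> v \<bullet> (M *v v)"
proof -
  obtain e where e: "eigenvalue M e" "e * (norm v)\<^sup>2 \<le> v \<bullet> (M *v v)"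
    using rayleigh_minimum[OF assms] by blast
  have "lambda_min M \<le> e"
    unfolding lambda_min_def using e(1) finite_eigenvalues[OF assms] by (simp add: Min_le)
  then show ?thesis
    using e(2) by (meson mult_right_mono order_trans zero_le_power2)
qed

lemma eigenvalue_lambda_min:
  fixes M :: "real^'n^'n"
  assumes "transpose M = M"
  shows "eigenvalue M (lambda_min M)"
proof -
  have "{e. eigenvalue M e} \<noteq> {}"
    using rayleigh_minimum[OF assms] by blast
  then show ?thesis
    using Min_in[OF finite_eigenvalues[OF assms]] unfolding lambda_min_def by auto
qed

text \<open>The lower Rayleigh bound for \<open>- M\<close> is an upper one for \<open>M\<close>,
  and eigenvalues change sign along with the matrix.\<close>

lemma le_lambda_max_mult:
  fixes M :: "real^'n^'n"
  assumes sym: "transpose M = M"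
  shows "v \<bullet> (M *v v) \<le> lambda_max M * (norm v)\<^sup>2"
proof -
  have neg: "(- M) *v w = - (M *v w)" for w
    using matrix_vector_mult_diff_rdistrib[of 0 M w] by simp
  have "transpose (- M) = - M"
    using sym by (simp add: transpose_def vec_eq_iff)
  then obtain e where e: "eigenvalue (- M) e" "e * (norm v)\<^sup>2 \<le> v \<bullet> ((- M) *v v)"
    using rayleigh_minimum by blast
  have "eigenvalue M (- e)"
    using e(1) unfolding eigenvalue_def neg by (metis minus_equation_iff scaleR_minus_left)
  then have "- e \<le> lambda_max M"
    unfolding lambda_max_def using finite_eigenvalues[OF sym] by simp
  then have "- e * (norm v)\<^sup>2 \<le> lambda_max M * (norm v)\<^sup>2"
    by (rule mult_right_mono) simp
  then show ?thesis using e(2) by (simp add: neg)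
qed

lemma lambda_min_gram_mult_le:
  fixes M :: "real^'n^'m"
  shows "lambda_min (transpose M ** M) * (norm v)\<^sup>2 \<le> (norm (M *v v))\<^sup>2"
  using lambda_min_mult_le[OF symmetric_gram, of M v] by (simp only: inner_gram)

lemma le_lambda_max_gram_mult:
  fixes M :: "real^'n^'m"
  shows "(norm (M *v v))\<^sup>2 \<le> lambda_max (transpose M ** M) * (norm v)\<^sup>2"
  using le_lambda_max_mult[OF symmetric_gram, of v M] by (simp only: inner_gram)

lemma lambda_min_gram_attained:
  fixes M :: "real^'n^'m"
  obtains u where "u \<noteq> 0" "(norm (M *v u))\<^sup>2 = lambda_min (transpose M ** M) * (norm u)\<^sup>2"
proof -
  obtain u where "u \<noteq> 0" "(transpose M ** M) *v u = lambda_min (transpose M ** M) *\<^sub>R u"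
    using eigenvalue_lambda_min[OF symmetric_gram, of M] unfolding eigenvalue_def by blast
  then show thesis
    using that[of u] inner_gram[of u M] by (simp add: power2_norm_eq_inner)
qed

lemma inner_image_le_lambda_max_gram:
  fixes M :: "real^'n^'m"
  shows "\<bar>(M *v x) \<bullet> (M *v y)\<bar> \<le> lambda_max (transpose M ** M) * norm x * norm y"
proof -
  let ?l = "lambda_max (transpose M ** M)"
  \<comment> \<open>Any unit vector shows that the largest Gram eigenvalue is nonnegative, so its
    square root can be used; the coordinate \<open>undefined\<close> is an arbitrary choice.\<close>
  have "0 \<le> ?l * (norm (axis undefined 1 :: real^'n))\<^sup>2"
    using le_lambda_max_gram_mult[of M "axis undefined 1"] by (meson order_trans zero_le_power2)
  then have l: "0 \<le> ?l" by simp
  have bound: "norm (M *v w) \<le> sqrt ?l * norm w" for w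
    using real_sqrt_le_mono[OF le_lambda_max_gram_mult[of M w]] by (simp add: real_sqrt_mult)
  have "\<bar>(M *v x) \<bullet> (M *v y)\<bar> \<le> norm (M *v x) * norm (M *v y)"
    by (rule Cauchy_Schwarz_ineq2)
  also have "\<dots> \<le> (sqrt ?l * norm x) * (sqrt ?l * norm y)"
    using bound l by (intro mult_mono) auto
  also have "\<dots> = ?l * norm x * norm y"
    using l by (simp add: algebra_simps flip: power2_eq_square)
  finally show ?thesis .
qed

section \<open>Row space and null space\<close>

text \<open>Full row rank makes the transpose of \<open>L\<close> injective, so it cannot annihilate
  the eigenvector at which the smallest Gram eigenvalue is attained. Positivity of
  \<open>\<zeta>\<close> rests on this.\<close>

lemma lambda_min_full_row_rank_pos:
  fixes L :: "real^'n^'k"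
  assumes "rank L = CARD('k)"
  shows "0 < lambda_min (L ** transpose L)"
proof -
  have inj: "inj ((*v) (transpose L))"
    using assms full_rank_injective[of "transpose L"] unfolding rank_transpose by blast
  obtain u :: "real^'k" where u: "u \<noteq> 0"
    and eq: "(norm (transpose L *v u))\<^sup>2 = lambda_min (L ** transpose L) * (norm u)\<^sup>2"
    using lambda_min_gram_attained[of "transpose L"] by (auto simp only: transpose_transpose)
  have "transpose L *v u \<noteq> 0"
    using inj u by (metis injD matrix_vector_mult_0_right)
  then have "0 < lambda_min (L ** transpose L) * (norm u)\<^sup>2"
    unfolding eq[symmetric] by (simp only: zero_less_power2 norm_eq_zero not_False_eq_True)
  then show ?thesis by (simp add: zero_less_mult_iff)
qed

text \<open>The eigenvalue controls \<open>w\<close> by \<open>z\<close>, while the squared norm of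
  \<open>z\<close> is the inner product of \<open>L *v z\<close> and \<open>w\<close>.
  Cauchy-Schwarz and elimination of \<open>w\<close> leave the claim multiplied by the squared norm
  of \<open>z\<close>.\<close>

lemma lambda_min_mult_le_row_space:
  fixes L :: "real^'n^'k"
  assumes pos: "0 < lambda_min (L ** transpose L)" and z: "z = transpose L *v w"
  shows "lambda_min (L ** transpose L) * (norm z)\<^sup>2 \<le> (norm (L *v z))\<^sup>2"
proof (cases "z = 0")
  case False
  let ?l = "lambda_min (L ** transpose L)"
  have "?l * (norm w)\<^sup>2 \<le> (norm z)\<^sup>2"
    using lambda_min_gram_mult_le[of "transpose L" w] by (simp only: transpose_transpose z)
  then have upper: "?l * (norm w)\<^sup>2 * (norm (L *v z))\<^sup>2 \<le> (norm z)\<^sup>2 * (norm (L *v z))\<^sup>2"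
    by (rule mult_right_mono) simp
  have "(norm z)\<^sup>2 \<le> norm w * norm (L *v z)"
  proof -
    have "(norm z)\<^sup>2 = (L *v z) \<bullet> w"
      using z by (simp only: inner_matrix_vector_transpose power2_norm_eq_inner)
    then show ?thesis
      using norm_cauchy_schwarz[of "L *v z" w] by (simp add: mult.commute)
  qed
  then have "((norm z)\<^sup>2)\<^sup>2 \<le> (norm w)\<^sup>2 * (norm (L *v z))\<^sup>2"
    by (metis power_mono power_mult_distrib zero_le_power2)
  then have "?l * ((norm z)\<^sup>2)\<^sup>2 \<le> ?l * ((norm w)\<^sup>2 * (norm (L *v z))\<^sup>2)"
    using pos by (intro mult_left_mono) auto
  with upper have "?l * ((norm z)\<^sup>2)\<^sup>2 \<le> (norm z)\<^sup>2 * (norm (L *v z))\<^sup>2"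
    by linarith
  then have "(norm z)\<^sup>2 * (?l * (norm z)\<^sup>2) \<le> (norm z)\<^sup>2 * (norm (L *v z))\<^sup>2"
    by (simp only: power2_eq_square ac_simps)
  then show ?thesis using False by simp
qed simp

lemma span_columns_eq_range:
  fixes M :: "real^'n^'m"
  shows "span (columns M) = range ((*v) M)"
proof
  have "columns M \<subseteq> range ((*v) M)"
    unfolding columns_def by (auto simp: matrix_vector_mult_basis[symmetric])
  then show "span (columns M) \<subseteq> range ((*v) M)"
    by (intro span_minimal linear_subspace_image) auto
qed (auto intro: matrix_vector_mult_in_columnspace)

lemma row_space_null_space_decomp:
  fixes L :: "real^'n^'k"
  obtains w y where "x = transpose L *v w + y" "L *v y = 0" "(transpose L *v w) \<bullet> y = 0"
proof -
  have sub: "subspace (range ((*v) (transpose L)))"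
    using span_columns_eq_range[of "transpose L"] by (metis subspace_span)
  obtain z y where z: "z \<in> span (range ((*v) (transpose L)))"
    and orth: "\<And>v. v \<in> span (range ((*v) (transpose L))) \<Longrightarrow> orthogonal y v" and x: "x = z + y"
    using orthogonal_subspace_decomp_exists[of "range ((*v) (transpose L))" x] by metis
  obtain w where w: "z = transpose L *v w"
    using z unfolding span_eq_iff[THEN iffD2, OF sub] by blast
  \<comment> \<open>Orthogonality to this particular row space vector says that
    \<open>L *v y\<close> has norm zero.\<close>
  have "orthogonal y (transpose L *v (L *v y))"
    by (intro orth span_base rangeI)
  then have "L *v y = 0"
    unfolding orthogonal_def inner_matrix_vector_transpose[symmetric] by simp
  moreover have "z \<bullet> y = 0"
    using orth[OF z] by (simp add: orthogonal_def inner_commute)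
  ultimately show thesis using that x unfolding w by blast
qed

lemma norm_orthonormal_columns:
  fixes F :: "real^'p^'n"
  assumes "columns_orthonormal_basis F V"
  shows "norm (F *v v) = norm v"
proof -
  have "transpose F ** F = mat 1"
    using assms unfolding columns_orthonormal_basis_def
    by (simp add: vec_eq_iff matrix_matrix_mult_def transpose_def mat_def column_def inner_vec_def)
  then have "(norm (F *v v))\<^sup>2 = (norm v)\<^sup>2"
    using inner_gram[of v F] by (simp add: power2_norm_eq_inner)
  then show ?thesis by simp
qed

lemma columns_orthonormal_basis_range:
  fixes F :: "real^'p^'n"
  assumes "columns_orthonormal_basis F V"
  shows "range ((*v) F) = V"
  using assms span_columns_eq_range unfolding columns_orthonormal_basis_def by metis

section \<open>The bordered Gram matrix\<close>

definition append_column :: "real^'p^'m \<Rightarrow> real^'m \<Rightarrow> real^('p + 1)^'m" where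
  "append_column G b = (\<chi> i j. case j of Inl p \<Rightarrow> G $ i $ p | Inr _ \<Rightarrow> b $ i)"

lemma sum_UNIV_append:
  fixes f :: "'p::finite + 1 \<Rightarrow> real"
  shows "(\<Sum>j\<in>UNIV. f j) = (\<Sum>p\<in>UNIV. f (Inl p)) + f (Inr 1)"
proof -
  have "(\<Sum>j\<in>UNIV <+> UNIV. f j) = (\<Sum>p\<in>UNIV. f (Inl p)) + (\<Sum>q\<in>UNIV. f (Inr q))"
    by (subst sum.Plus) (auto simp: comp_def)
  then show ?thesis by (simp only: UNIV_Plus_UNIV) simp
qed

lemma append_column_mult:
  "append_column G b *v u = G *v (\<chi> p. u $ Inl p) + u $ Inr 1 *\<^sub>R b"
  by (simp add: append_column_def vec_eq_iff matrix_vector_mult_def sum_UNIV_append)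

lemma norm_append_component:
  fixes u :: "real^('p::finite + 1)"
  shows "(norm u)\<^sup>2 = (norm (\<chi> p. u $ Inl p))\<^sup>2 + (u $ Inr 1)\<^sup>2"
  unfolding power2_norm_eq_inner by (simp add: inner_vec_def sum_UNIV_append power2_eq_square)

text \<open>With \<open>G = A ** F\<close> the left side is the matrix defining
  \<open>l\<^sub>2\<close>. Being the Gram matrix of \<open>G\<close> bordered by \<open>b\<close>,
  it is symmetric and falls under the Gram estimates above.\<close>

lemma block_matrix_eq_gram:
  fixes G :: "real^'p^'m"
  shows "block_matrix (transpose G ** G) (transpose G ** (columnvector b :: real^1^'m))
           ((rowvector b :: real^'m^1) ** G) (mat ((norm b)\<^sup>2))
         = transpose (append_column G b) ** append_column G b"
  unfolding vec_eq_iff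
proof (intro allI)
  fix i j :: "'p + 1"
  have one: "(p = q) = True" for p q :: 1
    by (metis num1_eq1)
  show "block_matrix (transpose G ** G) (transpose G ** (columnvector b :: real^1^'m))
           ((rowvector b :: real^'m^1) ** G) (mat ((norm b)\<^sup>2)) $ i $ j
         = (transpose (append_column G b) ** append_column G b) $ i $ j"
    unfolding power2_norm_eq_inner
    by (cases i; cases j)
      (auto simp: block_matrix_def append_column_def matrix_matrix_mult_def transpose_def
        columnvector_def rowvector_def mat_def inner_vec_def one)
qed

lemma homogenized_minimum_attained:
  fixes G :: "real^'p^'m" and b :: "real^'m"
  defines "l \<equiv> lambda_min (transpose (append_column G b) ** append_column G b)"
  assumes less: "l < lambda_min (transpose G ** G)"
  obtains v where "(norm (G *v v - b))\<^sup>2 = l * ((norm v)\<^sup>2 + 1)"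
proof -
  obtain u where u: "u \<noteq> 0" and eq: "(norm (append_column G b *v u))\<^sup>2 = l * (norm u)\<^sup>2"
    using lambda_min_gram_attained unfolding l_def by blast
  define v where "v = (\<chi> p. u $ Inl p)"
  define t where "t = u $ Inr 1"
  have eq': "(norm (G *v v + t *\<^sub>R b))\<^sup>2 = l * ((norm v)\<^sup>2 + t\<^sup>2)"
    using eq by (simp only: append_column_mult norm_append_component v_def t_def)
  have t: "t \<noteq> 0"
  proof
    \<comment> \<open>Otherwise \<open>v\<close> would be a nonzero vector at which the Rayleigh
      quotient of the Gram matrix of \<open>G\<close> equals \<open>l\<close>, below its smallest
      eigenvalue.\<close>
    assume t0: "t = 0"
    then have "(norm v)\<^sup>2 = (norm u)\<^sup>2"
      using norm_append_component[of u] by (simp add: v_def t_def)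
    then have "0 < (norm v)\<^sup>2"
      using u by simp
    moreover have "lambda_min (transpose G ** G) * (norm v)\<^sup>2 \<le> l * (norm v)\<^sup>2"
      using lambda_min_gram_mult_le[of G v] eq' t0 by simp
    ultimately show False using less by simp
  qed
  \<comment> \<open>This scaling turns the last coordinate into -1, so that the bordered matrix
    produces the residual with \<open>- b\<close>.\<close>
  define c where "c = - 1 / t"
  have c: "c * t = - 1" using t by (simp add: c_def)
  have "G *v (c *\<^sub>R v) - b = c *\<^sub>R (G *v v + t *\<^sub>R b)"
    using c by (simp add: matrix_vector_mult_scaleR scaleR_add_right)
  then have "(norm (G *v (c *\<^sub>R v) - b))\<^sup>2 = c\<^sup>2 * (norm (G *v v + t *\<^sub>R b))\<^sup>2"
    by (simp add: power_mult_distrib)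
  also have "\<dots> = l * (c\<^sup>2 * (norm v)\<^sup>2 + (c * t)\<^sup>2)"
    unfolding eq' by (simp add: power_mult_distrib algebra_simps)
  also have "\<dots> = l * ((norm (c *\<^sub>R v))\<^sup>2 + 1)"
    unfolding c by (simp add: power_mult_distrib)
  finally show thesis by (rule that)
qed

section \<open>Quadratic inequalities\<close>

lemma quadratic_le_imp_le_root:
  fixes d g c r :: real
  assumes d: "0 < d" and q: "d * r\<^sup>2 - g * r \<le> c"
  shows "r \<le> (g + sqrt (g\<^sup>2 + 4 * d * c)) / (2 * d)"
proof -
  have "4 * d * (d * r\<^sup>2 - g * r) \<le> 4 * d * c"
    using d q by (intro mult_left_mono) auto
  then have "(2 * d * r - g)\<^sup>2 \<le> g\<^sup>2 + 4 * d * c"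
    by (simp add: power2_eq_square algebra_simps)
  then have "2 * d * r - g \<le> sqrt (g\<^sup>2 + 4 * d * c)"
    by (rule real_le_rsqrt)
  then show ?thesis using d by (simp add: field_simps)
qed

lemma complete_square_lower_bound:
  fixes a p q :: real
  assumes "0 < a"
  shows "- (q\<^sup>2 / (4 * a)) \<le> a * p\<^sup>2 + q * p"
proof -
  have "a * p\<^sup>2 + q * p + q\<^sup>2 / (4 * a) = (2 * a * p + q)\<^sup>2 / (4 * a)"
    using assms by (simp add: field_simps power2_eq_square)
  then show ?thesis using assms by (smt (verit) divide_nonneg_pos zero_le_power2)
qed

lemma coupled_quadratic_bound:
  fixes r s d g h z l :: real
  assumes d: "0 < d" and z: "0 < z" and r: "0 \<le> r"
    and ineq: "d * r\<^sup>2 - g * r - h * r * s + z * s\<^sup>2 * r\<^sup>2 + z * (s\<^sup>2)\<^sup>2 + (z - l) * s\<^sup>2 \<le> l"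
  shows "s\<^sup>2 + r\<^sup>2 \<le> - 1 / 2 + l / (2 * z)
     + sqrt ((z - l)\<^sup>2 + h\<^sup>2 + 4 * z * l + g\<^sup>2 / d * z) / (2 * z)
     + ((g + sqrt (g\<^sup>2 + d * (4 * l + h\<^sup>2 / z + (z - l)\<^sup>2 / z))) / (2 * d))\<^sup>2"
proof -
  \<comment> \<open>The mixed quartic term absorbs the cross term in \<open>r * s\<close>, at the
    cost of a constant; afterwards \<open>r\<close> and \<open>s\<close> are decoupled.\<close>
  have "- (h\<^sup>2 / (4 * z)) \<le> z * s\<^sup>2 * r\<^sup>2 - h * r * s"
    using complete_square_lower_bound[OF z, of "- h" "r * s"]
    by (simp add: power_mult_distrib algebra_simps)
  with ineq have main: "d * r\<^sup>2 - g * r + (z * (s\<^sup>2)\<^sup>2 + (z - l) * s\<^sup>2) \<le> l + h\<^sup>2 / (4 * z)"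
    by simp
  \<comment> \<open>Replacing the part in \<open>s\<close> by its minimum leaves a quadratic
    inequality in \<open>r\<close> alone.\<close>
  have "d * r\<^sup>2 - g * r \<le> l + h\<^sup>2 / (4 * z) + (z - l)\<^sup>2 / (4 * z)"
    using main complete_square_lower_bound[OF z, of "z - l" "s\<^sup>2"] by simp
  from quadratic_le_imp_le_root[OF d this]
  have "r \<le> (g + sqrt (g\<^sup>2 + 4 * d * (l + h\<^sup>2 / (4 * z) + (z - l)\<^sup>2 / (4 * z)))) / (2 * d)" .
  moreover have "4 * d * (l + h\<^sup>2 / (4 * z) + (z - l)\<^sup>2 / (4 * z)) = d * (4 * l + h\<^sup>2 / z + (z - l)\<^sup>2 / z)"
    using z by (simp add: field_simps)
  ultimately have "r \<le> (g + sqrt (g\<^sup>2 + d * (4 * l + h\<^sup>2 / z + (z - l)\<^sup>2 / z))) / (2 * d)"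
    by simp
  then have r2: "r\<^sup>2 \<le> ((g + sqrt (g\<^sup>2 + d * (4 * l + h\<^sup>2 / z + (z - l)\<^sup>2 / z))) / (2 * d))\<^sup>2"
    using r by (rule power_mono)
  \<comment> \<open>Symmetrically, the part in \<open>r\<close> is replaced by its minimum, and the
    unknown is now \<open>s\<^sup>2\<close>.\<close>
  have "z * (s\<^sup>2)\<^sup>2 - (l - z) * s\<^sup>2 \<le> l + h\<^sup>2 / (4 * z) + g\<^sup>2 / (4 * d)"
    using main complete_square_lower_bound[OF d, of "- g" r] by (simp add: algebra_simps)
  from quadratic_le_imp_le_root[OF z this]
  have "s\<^sup>2 \<le> ((l - z) + sqrt ((l - z)\<^sup>2 + 4 * z * (l + h\<^sup>2 / (4 * z) + g\<^sup>2 / (4 * d)))) / (2 * z)" .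
  moreover have "(l - z)\<^sup>2 + 4 * z * (l + h\<^sup>2 / (4 * z) + g\<^sup>2 / (4 * d))
      = (z - l)\<^sup>2 + h\<^sup>2 + 4 * z * l + g\<^sup>2 / d * z"
    using z d by (simp add: field_simps power2_eq_square)
  moreover have "((l - z) + w) / (2 * z) = - 1 / 2 + l / (2 * z) + w / (2 * z)" for w
    using z by (simp add: field_simps)
  ultimately have "s\<^sup>2 \<le> - 1 / 2 + l / (2 * z)
     + sqrt ((z - l)\<^sup>2 + h\<^sup>2 + 4 * z * l + g\<^sup>2 / d * z) / (2 * z)"
    by simp
  with r2 show ?thesis by linarith
qed

section \<open>The bound on the minimiser\<close>

theorem theorem7:
  fixes A :: "real^'n^'m" and b :: "real^'m" and L :: "real^'n^'k" and F :: "real^'p^'n"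
    and \<rho> l\<^sub>1 l\<^sub>2 \<beta> \<gamma> \<zeta> :: real and x :: "real^'n"
  assumes "1 \<le> CARD('k)" and "CARD('k) < CARD('n)"
    and "CARD('p) = CARD('n) - CARD('k)"
    and "\<rho> > 0"
    and "rank L = CARD('k)"
    and "columns_orthonormal_basis F (null_space L)"
    and "l\<^sub>1 = lambda_min (transpose F ** transpose A ** A ** F)"
    and "l\<^sub>2 = lambda_min (block_matrix
           (transpose F ** transpose A ** A ** F)
           (transpose F ** transpose A ** (columnvector b :: real^1^'m))
           ((rowvector b :: real^'m^1) ** A ** F)
           (mat ((norm b)\<^sup>2) :: real^1^1))"
    and "l\<^sub>2 < l\<^sub>1"
    and "is_arg_min (\<lambda>y. (norm (A *v y - b))\<^sup>2 / ((norm y)\<^sup>2 + 1) + \<rho> * (norm (L *v y))\<^sup>2)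
           (\<lambda>y. True) x"
    and "\<beta> = 2 * lambda_max (transpose A ** A)"
    and "\<gamma> = 2 * norm (transpose A *v b)"
    and "\<zeta> = \<rho> * lambda_min (L ** transpose L)"
  shows "(norm x)\<^sup>2 \<le> - 1 / 2 + l\<^sub>2 / (2 * \<zeta>)
     + sqrt ((\<zeta> - l\<^sub>2)\<^sup>2 + \<beta>\<^sup>2 + 4 * \<zeta> * l\<^sub>2 + \<gamma>\<^sup>2 / (l\<^sub>1 - l\<^sub>2) * \<zeta>) / (2 * \<zeta>)
     + ((\<gamma> + sqrt (\<gamma>\<^sup>2 + (l\<^sub>1 - l\<^sub>2) * (4 * l\<^sub>2 + \<beta>\<^sup>2 / \<zeta> + (\<zeta> - l\<^sub>2)\<^sup>2 / \<zeta>)))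
          / (2 * (l\<^sub>1 - l\<^sub>2)))\<^sup>2"
proof -
  define G where "G = A ** F"
  note F = assms(6)
  have gram: "transpose F ** transpose A ** A ** F = transpose G ** G"
    and border: "transpose F ** transpose A ** (columnvector b :: real^1^'m) = transpose G ** columnvector b"
      "(rowvector b :: real^'m^1) ** A ** F = rowvector b ** G"
    unfolding G_def by (simp_all add: matrix_transpose_mul matrix_mul_assoc)
  have l1: "l\<^sub>1 = lambda_min (transpose G ** G)"
    using assms(7) unfolding gram .
  have l2: "l\<^sub>2 = lambda_min (transpose (append_column G b) ** append_column G b)"
    using assms(8) unfolding gram border block_matrix_eq_gram .
  have GF: "G *v v = A *v (F *v v)" for v
    unfolding G_def by (rule matrix_vector_mul_assoc[symmetric])
  have LF: "L *v (F *v v) = 0" for v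
    using columns_orthonormal_basis_range[OF F] by (auto simp: null_space_def)

  obtain u where u: "(norm (G *v u - b))\<^sup>2 = l\<^sub>2 * ((norm u)\<^sup>2 + 1)"
    using homogenized_minimum_attained assms(9) unfolding l1 l2 by blast
  have "(norm u)\<^sup>2 + 1 \<noteq> 0"
    by (smt (verit) zero_le_power2)
  \<comment> \<open>The competitor is \<open>F *v u\<close>: it has the norm of \<open>u\<close>,
    its penalty vanishes, and its fractional term equals \<open>l\<^sub>2\<close>.\<close>
  then have "(norm (A *v x - b))\<^sup>2 / ((norm x)\<^sup>2 + 1) + \<rho> * (norm (L *v x))\<^sup>2 \<le> l\<^sub>2"
    using assms(10) u LF[of u] norm_orthonormal_columns[OF F, of u]
    unfolding is_arg_min_linorder by (auto dest!: spec[of _ "F *v u"] simp: GF)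
  moreover have "0 < (norm x)\<^sup>2 + 1"
    by (smt (verit) zero_le_power2)
  ultimately have opt: "(norm (A *v x - b))\<^sup>2 + \<rho> * (norm (L *v x))\<^sup>2 * ((norm x)\<^sup>2 + 1)
      \<le> l\<^sub>2 * ((norm x)\<^sup>2 + 1)"
    by (simp add: field_simps)

  obtain w y where x: "x = transpose L *v w + y" and y: "L *v y = 0"
    and orth: "(transpose L *v w) \<bullet> y = 0"
    using row_space_null_space_decomp .
  define z where "z = transpose L *v w"
  obtain v where v: "y = F *v v"
    using y columns_orthonormal_basis_range[OF F] by (auto simp: null_space_def)
  define r s where "r = norm v" and "s = norm z"
  have r: "norm y = r"
    unfolding v r_def by (rule norm_orthonormal_columns[OF F])
  have xzy: "x = z + y" using x z_def by simp
  have nx: "(norm x)\<^sup>2 = s\<^sup>2 + r\<^sup>2"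
    unfolding xzy s_def r[symmetric]
    using orth by (intro norm_add_Pythagorean) (simp add: orthogonal_def z_def)
  have lpos: "0 < lambda_min (L ** transpose L)"
    using assms(5) by (rule lambda_min_full_row_rank_pos)
  have Lx: "L *v x = L *v z"
    unfolding xzy by (simp add: matrix_vector_right_distrib y)
  have "\<zeta> * s\<^sup>2 \<le> \<rho> * (norm (L *v x))\<^sup>2"
    using lambda_min_mult_le_row_space[OF lpos z_def] assms(4)
    unfolding assms(13) Lx s_def by simp
  then have "\<zeta> * s\<^sup>2 * (s\<^sup>2 + r\<^sup>2 + 1) \<le> \<rho> * (norm (L *v x))\<^sup>2 * ((norm x)\<^sup>2 + 1)"
    unfolding nx by (rule mult_right_mono) (simp add: add_nonneg_nonneg)
  moreover have "l\<^sub>1 * r\<^sup>2 - \<beta> * r * s - \<gamma> * r \<le> (norm (A *v x - b))\<^sup>2"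
  proof -
    have "A *v x - b = A *v y + (A *v z - b)"
      unfolding xzy by (simp add: matrix_vector_right_distrib)
    then have "(norm (A *v x - b))\<^sup>2 = (norm (A *v y))\<^sup>2 + (norm (A *v z - b))\<^sup>2
        + 2 * ((A *v y) \<bullet> (A *v z)) - 2 * ((A *v y) \<bullet> b)"
      unfolding power2_norm_eq_inner
      by (simp add: inner_add_left inner_add_right inner_diff_right inner_commute)
    moreover have "l\<^sub>1 * r\<^sup>2 \<le> (norm (A *v y))\<^sup>2"
      unfolding v GF[symmetric] l1 r_def by (rule lambda_min_gram_mult_le)
    moreover have "- (\<beta> * r * s) \<le> 2 * ((A *v y) \<bullet> (A *v z))"
    proof -
      \<comment> \<open>The 2 in the definition of \<open>\<beta>\<close> accounts for the doubled
        cross term of the expanded square; the 2 in \<open>\<gamma>\<close> does the same for the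
        term with \<open>b\<close>.\<close>
      have "\<bar>(A *v y) \<bullet> (A *v z)\<bar> \<le> \<beta> / 2 * r * s"
        using inner_image_le_lambda_max_gram[of A y z] assms(11) by (simp only: r s_def)
      then show ?thesis by linarith
    qed
    moreover have "2 * ((A *v y) \<bullet> b) \<le> \<gamma> * r"
      using norm_cauchy_schwarz[of y "transpose A *v b"]
      unfolding assms(12) inner_matrix_vector_transpose r by (simp add: mult.commute)
    ultimately show ?thesis by (smt (verit) zero_le_power2)
  qed
  ultimately have "l\<^sub>1 * r\<^sup>2 - \<beta> * r * s - \<gamma> * r + \<zeta> * s\<^sup>2 * (s\<^sup>2 + r\<^sup>2 + 1) \<le> l\<^sub>2 * (s\<^sup>2 + r\<^sup>2 + 1)"
    using opt unfolding nx by linarith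
  \<comment> \<open>The summand 1 from the denominator contributes
    \<open>\<zeta> * s\<^sup>2\<close> on the left and the constant \<open>l\<^sub>2\<close> on the
    right.\<close>
  then have "(l\<^sub>1 - l\<^sub>2) * r\<^sup>2 - \<gamma> * r - \<beta> * r * s + \<zeta> * s\<^sup>2 * r\<^sup>2 + \<zeta> * (s\<^sup>2)\<^sup>2 + (\<zeta> - l\<^sub>2) * s\<^sup>2 \<le> l\<^sub>2"
    by (simp add: algebra_simps power2_eq_square)
  moreover have "0 < \<zeta>"
    using lpos assms(4) unfolding assms(13) by simp
  ultimately show ?thesis
    using coupled_quadratic_bound[of "l\<^sub>1 - l\<^sub>2" \<zeta> r] assms(9) unfolding nx r_def by simp
qed

end
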